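(* Let $(X,d)$ and $(Y,\mu)$ be metric spaces, let $\mathcal B$ be a bornology on $X$, let $\Gamma$ be a directed set, let $I$ be a non-trivial ideal of $\Gamma$, and let $((D_\gamma,u_\gamma))_{\gamma\in\Gamma}$ be a net in $\mathcal P[X,Y]$. Then for every $(D,u)\in\mathcal P[X,Y]$: (1) $\mathrm{Gr}(u)\in(\mathcal B_I^* )^-\text{-}\lim \mathrm{Gr}(u_\gamma)$ if and only if $(D,u)\in\mathcal P_I^-(\mathcal B)\text{-}\lim(D_\gamma,u_\gamma)$; (2) $\mathrm{Gr}(u)\in(\mathcal B_I^* )^+\text{-}\lim \mathrm{Gr}(u_\gamma)$ if and only if $(D,u)\in\mathcal P_I^+(\mathcal B)\text{-}\lim(D_\gamma,u_\gamma)$.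
   Context: A partial map from $(X,d)$ to $(Y,\mu)$ is a pair $(D,u)$ where $D$ is a nonempty closed subset of $X$ and $u:D\to Y$ is a function (not assumed continuous); $\mathcal P[X,Y]$ is the set of all partial maps. The graph is $\mathrm{Gr}(u)=\{(x,u(x)):x\in D\}\subset X\times Y$. A bornology on a metric space is a family of nonempty subsets that covers the space, is closed under finite unions, and is closed under taking nonempty subsets. $\mathcal B^*$ denotes the bornology on $X\times Y$ consisting of all nonempty subsets of sets of the form $B\times Y$ with $B\in\mathcal B$. The product $X\times Y$ carries the box metric $(d\times\mu)((x_1,y_1),(x_2,y_2))=\max\{d(x_1,x_2),\mu(y_1,y_2)\}$. For a subset $A$ of a metric space and $\epsilon>0$, $A^\epsilon$ is the union of the open $\epsilon$-balls centered at points of $A$ (so $\emptyset^\epsilon=\emptyset$). A directed set is a nonempty set $\Gamma$ with a reflexive transitive relation $\ge$ such that any two elements have a common upper bound. An ideal $I$ of $\Gamma$ is a family of subsets of $\Gamma$ containing $\emptyset$ and closed under finite unions and under taking subsets; it is non-trivial if $I\ne\{\emptyset\}$ and $\Gamma\notin I$. $\mathbb F(I)=\{A\subset\Gamma:\Gamma\setminus A\in I\}$ is the associated filter. For nonempty subsets $E$ and $E_\gamma$ ($\gamma\in\Gamma$) of $X\times Y$: $E\in(\mathcal B_I^* )^-\text{-}\lim E_\gamma$ means that for every $S\in\mathcal B^*$ and $\epsilon>0$, $\{\gamma\in\Gamma:E\cap S\subset E_\gamma^\epsilon\}\in\mathbb F(I)$; and $E\in(\mathcal B_I^* )^+\text{-}\lim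 E_\gamma$ means that for every $S\in\mathcal B^*$ and $\epsilon>0$, $\{\gamma\in\Gamma:E_\gamma\cap S\subset E^\epsilon\}\in\mathbb F(I)$. $(D,u)\in\mathcal P_I^-(\mathcal B)\text{-}\lim(D_\gamma,u_\gamma)$ means: for every $B\in\mathcal B$ and $\epsilon>0$, $\{\gamma\in\Gamma:\text{ for every nonempty } B_1\subset B,\ u(D\cap B_1)\subset[u_\gamma(D_\gamma\cap B_1^\epsilon)]^\epsilon\}\in\mathbb F(I)$. $(D,u)\in\mathcal P_I^+(\mathcal B)\text{-}\lim(D_\gamma,u_\gamma)$ means: for every $B\in\mathcal B$ and $\epsilon>0$, $\{\gamma\in\Gamma:\text{ for every nonempty } B_1\subset B,\ u_\gamma(D_\gamma\cap B_1)\subset[u(D\cap B_1^\epsilon)]^\epsilon\}\in\mathbb F(I)$. *)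

theory Defs
  imports "HOL-Analysis.Analysis"
begin

text \<open>
  Metric spaces are given by a carrier and a distance function, as in the library locale
  \<^locale>\<open>Metric_space\<close>. The type-class metric on products and the library's
  product metric on carriers are both Euclidean, so the box metric is defined here.
\<close>

definition box_dist ::
  "('a \<Rightarrow> 'a \<Rightarrow> real) \<Rightarrow> ('b \<Rightarrow> 'b \<Rightarrow> real) \<Rightarrow> 'a \<times> 'b \<Rightarrow> 'a \<times> 'b \<Rightarrow> real" where
  "box_dist d \<mu> = (\<lambda>(x1, y1) (x2, y2). max (d x1 x2) (\<mu> y1 y2))"

lemma Metric_space_box_dist:
  assumes "Metric_space X d" and "Metric_space Y \<mu>"
  shows "Metric_space (X \<times> Y) (box_dist d \<mu>)"
proof -
  interpret X: Metric_space X d by fact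
  interpret Y: Metric_space Y \<mu> by fact
  show ?thesis
  proof
    fix p q :: "'a \<times> 'b"
    show "0 \<le> box_dist d \<mu> p q"
      by (auto simp: box_dist_def le_max_iff_disj split: prod.splits)
    show "box_dist d \<mu> p q = box_dist d \<mu> q p"
      by (auto simp: box_dist_def X.commute Y.commute split: prod.splits)
  next
    fix p q assume pq: "p \<in> X \<times> Y" "q \<in> X \<times> Y"
    obtain x y x' y' where [simp]: "p = (x, y)" "q = (x', y')" by (cases p, cases q) auto
    have "max (d x x') (\<mu> y y') = 0 \<longleftrightarrow> d x x' = 0 \<and> \<mu> y y' = 0"
      using X.nonneg[of x x'] Y.nonneg[of y y'] by linarith
    then show "box_dist d \<mu> p q = 0 \<longleftrightarrow> p = q"
      using pq by (auto simp: box_dist_def)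
  next
    fix p q r assume pqr: "p \<in> X \<times> Y" "q \<in> X \<times> Y" "r \<in> X \<times> Y"
    obtain x y x' y' x'' y'' where [simp]: "p = (x, y)" "q = (x', y')" "r = (x'', y'')"
      by (cases p, cases q, cases r) auto
    show "box_dist d \<mu> p r \<le> box_dist d \<mu> p q + box_dist d \<mu> q r"
      using pqr X.triangle[of x x' x''] Y.triangle[of y y' y'']
      by (auto simp: box_dist_def)
  qed
qed

definition enlargement :: "'a set \<Rightarrow> ('a \<Rightarrow> 'a \<Rightarrow> real) \<Rightarrow> 'a set \<Rightarrow> real \<Rightarrow> 'a set" where
  "enlargement M d A \<epsilon> = (\<Union>a\<in>A. Metric_space.mball M d a \<epsilon>)"

text \<open>
  A partial map is a pair of its domain and a function extensional on that domain, so
  that equality of pairs is equality of partial maps.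
\<close>

definition partial_maps ::
  "'a set \<Rightarrow> ('a \<Rightarrow> 'a \<Rightarrow> real) \<Rightarrow> 'b set \<Rightarrow> ('a set \<times> ('a \<Rightarrow> 'b)) set" where
  "partial_maps X d Y =
     {(D, u). D \<noteq> {} \<and> closedin (Metric_space.mtopology X d) D \<and> u \<in> D \<rightarrow>\<^sub>E Y}"

definition Gr :: "'a set \<Rightarrow> ('a \<Rightarrow> 'b) \<Rightarrow> ('a \<times> 'b) set" where
  "Gr D u = {(x, u x) | x. x \<in> D}"

text \<open>Members of a bornology are nonempty, so only nonempty finite unions are formed.\<close>

definition bornology :: "'a set \<Rightarrow> 'a set set \<Rightarrow> bool" where
  "bornology X \<B> \<longleftrightarrow>
     (\<forall>B\<in>\<B>. B \<noteq> {} \<and> B \<subseteq> X) \<and>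
     \<Union>\<B> = X \<and>
     (\<forall>F. finite F \<and> F \<noteq> {} \<and> F \<subseteq> \<B> \<longrightarrow> \<Union>F \<in> \<B>) \<and>
     (\<forall>B\<in>\<B>. \<forall>A. A \<noteq> {} \<and> A \<subseteq> B \<longrightarrow> A \<in> \<B>)"

definition star_bornology :: "'b set \<Rightarrow> 'a set set \<Rightarrow> ('a \<times> 'b) set set" where
  "star_bornology Y \<B> = {S. S \<noteq> {} \<and> (\<exists>B\<in>\<B>. S \<subseteq> B \<times> Y)}"

definition directed_set :: "'c set \<Rightarrow> ('c \<Rightarrow> 'c \<Rightarrow> bool) \<Rightarrow> bool" where
  "directed_set \<Gamma> ge \<longleftrightarrow>
     \<Gamma> \<noteq> {} \<and> reflp_on \<Gamma> ge \<and> transp_on \<Gamma> ge \<and>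
     (\<forall>\<alpha>\<in>\<Gamma>. \<forall>\<beta>\<in>\<Gamma>. \<exists>\<gamma>\<in>\<Gamma>. ge \<gamma> \<alpha> \<and> ge \<gamma> \<beta>)"

definition set_ideal :: "'c set \<Rightarrow> 'c set set \<Rightarrow> bool" where
  "set_ideal \<Gamma> I \<longleftrightarrow>
     I \<subseteq> Pow \<Gamma> \<and> {} \<in> I \<and>
     (\<forall>A\<in>I. \<forall>B\<in>I. A \<union> B \<in> I) \<and>
     (\<forall>A\<in>I. \<forall>B. B \<subseteq> A \<longrightarrow> B \<in> I)"

definition nontrivial_set_ideal :: "'c set \<Rightarrow> 'c set set \<Rightarrow> bool" where
  "nontrivial_set_ideal \<Gamma> I \<longleftrightarrow> set_ideal \<Gamma> I \<and> I \<noteq> {{}} \<and> \<Gamma> \<notin> I"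

definition ideal_filter :: "'c set \<Rightarrow> 'c set set \<Rightarrow> 'c set set" where
  "ideal_filter \<Gamma> I = {A. A \<subseteq> \<Gamma> \<and> \<Gamma> - A \<in> I}"

text \<open>
  In the next two definitions \<open>M\<close> and \<open>\<rho>\<close> are the carrier and the metric of an
  arbitrary metric space and \<open>\<S>\<close> is a bornology on it; below they are
  instantiated to the product with the box metric and to \<^const>\<open>star_bornology\<close>.
\<close>

definition lower_bornological_lim ::
  "'m set \<Rightarrow> ('m \<Rightarrow> 'm \<Rightarrow> real) \<Rightarrow> 'm set set \<Rightarrow> 'c set \<Rightarrow> 'c set set \<Rightarrow>
   'm set \<Rightarrow> ('c \<Rightarrow> 'm set) \<Rightarrow> bool" where
  "lower_bornological_lim M \<rho> \<S> \<Gamma> I E En \<longleftrightarrow>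
     (\<forall>S\<in>\<S>. \<forall>\<epsilon>>0.
        {\<gamma>\<in>\<Gamma>. E \<inter> S \<subseteq> enlargement M \<rho> (En \<gamma>) \<epsilon>} \<in> ideal_filter \<Gamma> I)"

definition upper_bornological_lim ::
  "'m set \<Rightarrow> ('m \<Rightarrow> 'm \<Rightarrow> real) \<Rightarrow> 'm set set \<Rightarrow> 'c set \<Rightarrow> 'c set set \<Rightarrow>
   'm set \<Rightarrow> ('c \<Rightarrow> 'm set) \<Rightarrow> bool" where
  "upper_bornological_lim M \<rho> \<S> \<Gamma> I E En \<longleftrightarrow>
     (\<forall>S\<in>\<S>. \<forall>\<epsilon>>0.
        {\<gamma>\<in>\<Gamma>. En \<gamma> \<inter> S \<subseteq> enlargement M \<rho> E \<epsilon>} \<in> ideal_filter \<Gamma> I)"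

definition lower_partial_map_lim ::
  "'a set \<Rightarrow> ('a \<Rightarrow> 'a \<Rightarrow> real) \<Rightarrow> 'b set \<Rightarrow> ('b \<Rightarrow> 'b \<Rightarrow> real) \<Rightarrow> 'a set set \<Rightarrow>
   'c set \<Rightarrow> 'c set set \<Rightarrow> 'a set \<Rightarrow> ('a \<Rightarrow> 'b) \<Rightarrow>
   ('c \<Rightarrow> 'a set) \<Rightarrow> ('c \<Rightarrow> 'a \<Rightarrow> 'b) \<Rightarrow> bool" where
  "lower_partial_map_lim X d Y \<mu> \<B> \<Gamma> I D u Dn un \<longleftrightarrow>
     (\<forall>B\<in>\<B>. \<forall>\<epsilon>>0.
        {\<gamma>\<in>\<Gamma>. \<forall>B1. B1 \<noteq> {} \<and> B1 \<subseteq> B \<longrightarrow>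
           u ` (D \<inter> B1) \<subseteq> enlargement Y \<mu> (un \<gamma> ` (Dn \<gamma> \<inter> enlargement X d B1 \<epsilon>)) \<epsilon>}
        \<in> ideal_filter \<Gamma> I)"

definition upper_partial_map_lim ::
  "'a set \<Rightarrow> ('a \<Rightarrow> 'a \<Rightarrow> real) \<Rightarrow> 'b set \<Rightarrow> ('b \<Rightarrow> 'b \<Rightarrow> real) \<Rightarrow> 'a set set \<Rightarrow>
   'c set \<Rightarrow> 'c set set \<Rightarrow> 'a set \<Rightarrow> ('a \<Rightarrow> 'b) \<Rightarrow>
   ('c \<Rightarrow> 'a set) \<Rightarrow> ('c \<Rightarrow> 'a \<Rightarrow> 'b) \<Rightarrow> bool" where
  "upper_partial_map_lim X d Y \<mu> \<B> \<Gamma> I D u Dn un \<longleftrightarrow>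
     (\<forall>B\<in>\<B>. \<forall>\<epsilon>>0.
        {\<gamma>\<in>\<Gamma>. \<forall>B1. B1 \<noteq> {} \<and> B1 \<subseteq> B \<longrightarrow>
           un \<gamma> ` (Dn \<gamma> \<inter> B1) \<subseteq> enlargement Y \<mu> (u ` (D \<inter> enlargement X d B1 \<epsilon>)) \<epsilon>}
        \<in> ideal_filter \<Gamma> I)"

end

theory Submission
  imports Defs
begin

text \<open>
  Both equivalences hold index by index: for a fixed radius \<open>\<epsilon>\<close> and a fixed \<open>B \<in> \<B>\<close>, the
  set of indices tested on the graph side and the one tested on the partial-map side are equal.
  In the box metric, that the part of the graph of \<open>u\<close> over \<open>B\<close> lies in the
  \<open>\<epsilon>\<close>-enlargement of the graph of \<open>v\<close> means that every point \<open>x\<close> of \<open>B\<close> in the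
  domain of \<open>u\<close> has a partner \<open>e\<close> in the domain of \<open>v\<close> that is \<open>\<epsilon>\<close>-close to
  \<open>x\<close> while \<open>v e\<close> is \<open>\<epsilon>\<close>-close to \<open>u x\<close>. The inclusions between images over
  all \<open>B1 \<subseteq> B\<close> encode the same condition: taking \<open>B1 = {x}\<close> forces the partner to be
  close to \<open>x\<close> itself, not merely to \<open>B\<close>. This is
  \<open>graph_subset_enlargement_iff\<close>; the lower and the upper half of the theorem use it with
  the roles of the limit map and of the members of the net exchanged.

  What remains is that the graph limits quantify over all members of the product bornology rather
  than over the cylinders \<open>B \<times> Y\<close>. The cylinders are cofinal, the inclusions are inherited
  by smaller sets, and the filter of an ideal is closed under supersets, so testing the cylinders
  is enough (\<open>star_bornology_filter_iff\<close>).
\<close>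

lemma mem_enlargement_iff:
  assumes "Metric_space M d" and "A \<subseteq> M"
  shows "x \<in> enlargement M d A \<epsilon> \<longleftrightarrow> x \<in> M \<and> (\<exists>a\<in>A. d x a < \<epsilon>)"
proof -
  interpret Metric_space M d by fact
  show ?thesis
    using assms(2) by (auto simp: enlargement_def commute)
qed

lemma partial_mapsD:
  assumes "Metric_space X d" and "(D, u) \<in> partial_maps X d Y"
  shows "D \<noteq> {}" and "D \<subseteq> X" and "u \<in> D \<rightarrow> Y"
  using assms(2) closedin_subset[of "Metric_space.mtopology X d" D]
    Metric_space.topspace_mtopology[OF assms(1)]
  by (auto simp: partial_maps_def PiE_def)

lemma graph_subset_enlargement_iff_partner:
  assumes X: "Metric_space X d" and Y: "Metric_space Y \<mu>"
    and D: "D \<subseteq> X" "u \<in> D \<rightarrow> Y" and E: "E \<subseteq> X" "v \<in> E \<rightarrow> Y"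
  shows "Gr D u \<inter> B \<times> Y \<subseteq> enlargement (X \<times> Y) (box_dist d \<mu>) (Gr E v) \<epsilon> \<longleftrightarrow>
         (\<forall>x\<in>D \<inter> B. \<exists>e\<in>E. d x e < \<epsilon> \<and> \<mu> (u x) (v e) < \<epsilon>)"
proof -
  have "Gr E v \<subseteq> X \<times> Y"
    using E by (auto simp: Gr_def)
  note enl = mem_enlargement_iff[OF Metric_space_box_dist[OF X Y] this]
  have "Gr D u \<inter> B \<times> Y \<subseteq> enlargement (X \<times> Y) (box_dist d \<mu>) (Gr E v) \<epsilon> \<longleftrightarrow>
        (\<forall>x\<in>D \<inter> B. (x, u x) \<in> enlargement (X \<times> Y) (box_dist d \<mu>) (Gr E v) \<epsilon>)"
    using D by (auto simp: Gr_def)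
  also have "\<dots> \<longleftrightarrow> (\<forall>x\<in>D \<inter> B. \<exists>e\<in>E. d x e < \<epsilon> \<and> \<mu> (u x) (v e) < \<epsilon>)"
    unfolding enl using D by (fastforce simp: Gr_def box_dist_def)
  finally show ?thesis .
qed

lemma images_subset_enlargement_iff_partner:
  assumes X: "Metric_space X d" and Y: "Metric_space Y \<mu>"
    and D: "D \<subseteq> X" "u \<in> D \<rightarrow> Y" and E: "E \<subseteq> X" "v \<in> E \<rightarrow> Y"
    and B: "B \<subseteq> X"
  shows "(\<forall>B1. B1 \<noteq> {} \<and> B1 \<subseteq> B \<longrightarrow>
            u ` (D \<inter> B1) \<subseteq> enlargement Y \<mu> (v ` (E \<inter> enlargement X d B1 \<epsilon>)) \<epsilon>) \<longleftrightarrow>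
         (\<forall>x\<in>D \<inter> B. \<exists>e\<in>E. d x e < \<epsilon> \<and> \<mu> (u x) (v e) < \<epsilon>)"
    (is "?images \<longleftrightarrow> ?partner")
proof -
  interpret X: Metric_space X d by fact
  have mem: "y \<in> enlargement Y \<mu> (v ` (E \<inter> enlargement X d B1 \<epsilon>)) \<epsilon> \<longleftrightarrow>
             y \<in> Y \<and> (\<exists>e\<in>E. (\<exists>b\<in>B1. d e b < \<epsilon>) \<and> \<mu> y (v e) < \<epsilon>)"
    if "B1 \<subseteq> B" for y B1
  proof -
    have near: "E \<inter> enlargement X d B1 \<epsilon> = {e\<in>E. \<exists>b\<in>B1. d e b < \<epsilon>}"
      using E(1) B that by (subst set_eq_iff) (auto simp: mem_enlargement_iff[OF X])
    have image: "v ` {e\<in>E. \<exists>b\<in>B1. d e b < \<epsilon>} \<subseteq> Y"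
      using E(2) by auto
    show ?thesis
      unfolding near mem_enlargement_iff[OF Y image] by blast
  qed
  show ?thesis
  proof
    assume images: ?images
    show ?partner
    proof
      fix x assume x: "x \<in> D \<inter> B"
      \<comment> \<open>A larger test set would only yield a partner close to some other point of \<open>B\<close>.\<close>
      then have "u x \<in> enlargement Y \<mu> (v ` (E \<inter> enlargement X d {x} \<epsilon>)) \<epsilon>"
        using images[rule_format, of "{x}"] by auto
      then show "\<exists>e\<in>E. d x e < \<epsilon> \<and> \<mu> (u x) (v e) < \<epsilon>"
        using x by (auto simp: mem X.commute)
    qed
  next
    assume partner: ?partner
    show ?images
    proof (intro allI impI subsetI, elim conjE imageE)
      fix B1 y x
      assume "B1 \<subseteq> B" and y: "y = u x" and x: "x \<in> D \<inter> B1"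
      then obtain e where "e \<in> E" "d x e < \<epsilon>" "\<mu> (u x) (v e) < \<epsilon>"
        using partner by blast
      with x y D show "y \<in> enlargement Y \<mu> (v ` (E \<inter> enlargement X d B1 \<epsilon>)) \<epsilon>"
        unfolding mem[OF \<open>B1 \<subseteq> B\<close>] by (auto simp: X.commute)
    qed
  qed
qed

text \<open>
  Both sides say that every point of \<open>D \<inter> B\<close> has an \<open>\<epsilon>\<close>-close partner in \<open>E\<close> with
  an \<open>\<epsilon>\<close>-close value; the maximum in the box metric is what lets one \<open>\<epsilon>\<close> serve for both
  coordinates without loss.
\<close>

lemma graph_subset_enlargement_iff:
  assumes "Metric_space X d" and "Metric_space Y \<mu>"
    and "D \<subseteq> X" "u \<in> D \<rightarrow> Y" and "E \<subseteq> X" "v \<in> E \<rightarrow> Y"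
    and "B \<subseteq> X"
  shows "Gr D u \<inter> B \<times> Y \<subseteq> enlargement (X \<times> Y) (box_dist d \<mu>) (Gr E v) \<epsilon> \<longleftrightarrow>
         (\<forall>B1. B1 \<noteq> {} \<and> B1 \<subseteq> B \<longrightarrow>
            u ` (D \<inter> B1) \<subseteq> enlargement Y \<mu> (v ` (E \<inter> enlargement X d B1 \<epsilon>)) \<epsilon>)"
  using graph_subset_enlargement_iff_partner[OF assms(1-6)]
    images_subset_enlargement_iff_partner[OF assms] by simp

lemma ideal_filter_superset:
  assumes "set_ideal \<Gamma> I" and "A \<in> ideal_filter \<Gamma> I" and "A \<subseteq> A'" and "A' \<subseteq> \<Gamma>"
  shows "A' \<in> ideal_filter \<Gamma> I"
proof -
  have "\<Gamma> - A' \<subseteq> \<Gamma> - A"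
    using assms(3) by blast
  moreover have "\<Gamma> - A \<in> I"
    using assms(2) by (simp add: ideal_filter_def)
  ultimately have "\<Gamma> - A' \<in> I"
    using assms(1) unfolding set_ideal_def by (elim conjE) (drule (1) bspec, simp)
  then show ?thesis
    using assms(4) by (simp add: ideal_filter_def)
qed

text \<open>
  The cylinders are cofinal in the product bornology. Nonemptiness of \<open>Y\<close> makes them members
  of it.
\<close>

lemma star_bornology_filter_iff:
  assumes "bornology X \<B>" and "set_ideal \<Gamma> I" and "Y \<noteq> {}"
    and anti: "\<And>\<gamma> S T. S \<subseteq> T \<Longrightarrow> P \<gamma> T \<Longrightarrow> P \<gamma> S"
  shows "(\<forall>S\<in>star_bornology Y \<B>. {\<gamma>\<in>\<Gamma>. P \<gamma> S} \<in> ideal_filter \<Gamma> I) \<longleftrightarrow>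
         (\<forall>B\<in>\<B>. {\<gamma>\<in>\<Gamma>. P \<gamma> (B \<times> Y)} \<in> ideal_filter \<Gamma> I)"
    (is "?all \<longleftrightarrow> ?cylinders")
proof
  have "B \<times> Y \<in> star_bornology Y \<B>" if "B \<in> \<B>" for B
  proof -
    have "B \<noteq> {}"
      using that assms(1) by (simp add: bornology_def)
    with that assms(3) show ?thesis
      by (auto simp: star_bornology_def)
  qed
  then show "?cylinders" if ?all
    using that by blast
next
  assume cyl: ?cylinders
  show ?all
  proof
    fix S assume "S \<in> star_bornology Y \<B>"
    then obtain B where "B \<in> \<B>" and "S \<subseteq> B \<times> Y"
      by (auto simp: star_bornology_def)
    have "{\<gamma>\<in>\<Gamma>. P \<gamma> (B \<times> Y)} \<subseteq> {\<gamma>\<in>\<Gamma>. P \<gamma> S}"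
      using anti[OF \<open>S \<subseteq> B \<times> Y\<close>] by auto
    moreover have "{\<gamma>\<in>\<Gamma>. P \<gamma> (B \<times> Y)} \<in> ideal_filter \<Gamma> I"
      using cyl \<open>B \<in> \<B>\<close> by simp
    ultimately show "{\<gamma>\<in>\<Gamma>. P \<gamma> S} \<in> ideal_filter \<Gamma> I"
      using ideal_filter_superset[OF assms(2)] by simp
  qed
qed

theorem theorem3p4:
  fixes X :: "'a set" and d :: "'a \<Rightarrow> 'a \<Rightarrow> real"
    and Y :: "'b set" and \<mu> :: "'b \<Rightarrow> 'b \<Rightarrow> real"
    and \<B> :: "'a set set"
    and \<Gamma> :: "'c set" and ge :: "'c \<Rightarrow> 'c \<Rightarrow> bool" and I :: "'c set set"
    and Dn :: "'c \<Rightarrow> 'a set" and un :: "'c \<Rightarrow> 'a \<Rightarrow> 'b"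
    and D :: "'a set" and u :: "'a \<Rightarrow> 'b"
  assumes "Metric_space X d" and "Metric_space Y \<mu>"
    and "bornology X \<B>"
    and "directed_set \<Gamma> ge"
    and "nontrivial_set_ideal \<Gamma> I"
    and "\<And>\<gamma>. \<gamma> \<in> \<Gamma> \<Longrightarrow> (Dn \<gamma>, un \<gamma>) \<in> partial_maps X d Y"
    and "(D, u) \<in> partial_maps X d Y"
  shows "(lower_bornological_lim (X \<times> Y) (box_dist d \<mu>) (star_bornology Y \<B>) \<Gamma> I
           (Gr D u) (\<lambda>\<gamma>. Gr (Dn \<gamma>) (un \<gamma>))
         \<longleftrightarrow> lower_partial_map_lim X d Y \<mu> \<B> \<Gamma> I D u Dn un) \<and>
         (upper_bornological_lim (X \<times> Y) (box_dist d \<mu>) (star_bornology Y \<B>) \<Gamma> I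
           (Gr D u) (\<lambda>\<gamma>. Gr (Dn \<gamma>) (un \<gamma>))
         \<longleftrightarrow> upper_partial_map_lim X d Y \<mu> \<B> \<Gamma> I D u Dn un)"
proof -
  note X = \<open>Metric_space X d\<close> and Y = \<open>Metric_space Y \<mu>\<close> and born = \<open>bornology X \<B>\<close>
  note u = partial_mapsD[OF X \<open>(D, u) \<in> partial_maps X d Y\<close>]
  note un = partial_mapsD[OF X assms(6)]
  have ideal: "set_ideal \<Gamma> I"
    using \<open>nontrivial_set_ideal \<Gamma> I\<close> by (simp add: nontrivial_set_ideal_def)
  have "Y \<noteq> {}"
    using u by auto
  have sub: "B \<subseteq> X" if "B \<in> \<B>" for B
    using born that by (simp add: bornology_def)
  let ?enl = "enlargement (X \<times> Y) (box_dist d \<mu>)"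
  have lower_cylinders:
    "(\<forall>S\<in>star_bornology Y \<B>.
        {\<gamma>\<in>\<Gamma>. Gr D u \<inter> S \<subseteq> ?enl (Gr (Dn \<gamma>) (un \<gamma>)) \<epsilon>} \<in> ideal_filter \<Gamma> I) \<longleftrightarrow>
     (\<forall>B\<in>\<B>. {\<gamma>\<in>\<Gamma>. Gr D u \<inter> B \<times> Y \<subseteq> ?enl (Gr (Dn \<gamma>) (un \<gamma>)) \<epsilon>} \<in> ideal_filter \<Gamma> I)"
    for \<epsilon>
    by (rule star_bornology_filter_iff[OF born ideal \<open>Y \<noteq> {}\<close>]) blast
  have upper_cylinders:
    "(\<forall>S\<in>star_bornology Y \<B>.
        {\<gamma>\<in>\<Gamma>. Gr (Dn \<gamma>) (un \<gamma>) \<inter> S \<subseteq> ?enl (Gr D u) \<epsilon>} \<in> ideal_filter \<Gamma> I) \<longleftrightarrow>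
     (\<forall>B\<in>\<B>. {\<gamma>\<in>\<Gamma>. Gr (Dn \<gamma>) (un \<gamma>) \<inter> B \<times> Y \<subseteq> ?enl (Gr D u) \<epsilon>} \<in> ideal_filter \<Gamma> I)"
    for \<epsilon>
    by (rule star_bornology_filter_iff[OF born ideal \<open>Y \<noteq> {}\<close>]) blast
  have lower_indices:
    "{\<gamma>\<in>\<Gamma>. Gr D u \<inter> B \<times> Y \<subseteq> ?enl (Gr (Dn \<gamma>) (un \<gamma>)) \<epsilon>} =
     {\<gamma>\<in>\<Gamma>. \<forall>B1. B1 \<noteq> {} \<and> B1 \<subseteq> B \<longrightarrow>
        u ` (D \<inter> B1) \<subseteq> enlargement Y \<mu> (un \<gamma> ` (Dn \<gamma> \<inter> enlargement X d B1 \<epsilon>)) \<epsilon>}"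
    if "B \<in> \<B>" for B \<epsilon>
    by (rule Collect_cong, rule conj_cong[OF refl])
      (rule graph_subset_enlargement_iff[OF X Y u(2,3) un(2,3) sub[OF that]])
  have upper_indices:
    "{\<gamma>\<in>\<Gamma>. Gr (Dn \<gamma>) (un \<gamma>) \<inter> B \<times> Y \<subseteq> ?enl (Gr D u) \<epsilon>} =
     {\<gamma>\<in>\<Gamma>. \<forall>B1. B1 \<noteq> {} \<and> B1 \<subseteq> B \<longrightarrow>
        un \<gamma> ` (Dn \<gamma> \<inter> B1) \<subseteq> enlargement Y \<mu> (u ` (D \<inter> enlargement X d B1 \<epsilon>)) \<epsilon>}"
    if "B \<in> \<B>" for B \<epsilon>
    by (rule Collect_cong, rule conj_cong[OF refl])
      (rule graph_subset_enlargement_iff[OF X Y un(2,3) u(2,3) sub[OF that]])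
  show ?thesis
  proof
    have "lower_bornological_lim (X \<times> Y) (box_dist d \<mu>) (star_bornology Y \<B>) \<Gamma> I
            (Gr D u) (\<lambda>\<gamma>. Gr (Dn \<gamma>) (un \<gamma>)) \<longleftrightarrow>
          (\<forall>\<epsilon>>0. \<forall>B\<in>\<B>.
            {\<gamma>\<in>\<Gamma>. Gr D u \<inter> B \<times> Y \<subseteq> ?enl (Gr (Dn \<gamma>) (un \<gamma>)) \<epsilon>} \<in> ideal_filter \<Gamma> I)"
      unfolding lower_bornological_lim_def lower_cylinders[symmetric] by blast
    also have "\<dots> \<longleftrightarrow> lower_partial_map_lim X d Y \<mu> \<B> \<Gamma> I D u Dn un"
      by (simp add: lower_partial_map_lim_def lower_indices) blast
    finally show "lower_bornological_lim (X \<times> Y) (box_dist d \<mu>) (star_bornology Y \<B>) \<Gamma> I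
            (Gr D u) (\<lambda>\<gamma>. Gr (Dn \<gamma>) (un \<gamma>)) \<longleftrightarrow>
          lower_partial_map_lim X d Y \<mu> \<B> \<Gamma> I D u Dn un" .
  next
    have "upper_bornological_lim (X \<times> Y) (box_dist d \<mu>) (star_bornology Y \<B>) \<Gamma> I
            (Gr D u) (\<lambda>\<gamma>. Gr (Dn \<gamma>) (un \<gamma>)) \<longleftrightarrow>
          (\<forall>\<epsilon>>0. \<forall>B\<in>\<B>.
            {\<gamma>\<in>\<Gamma>. Gr (Dn \<gamma>) (un \<gamma>) \<inter> B \<times> Y \<subseteq> ?enl (Gr D u) \<epsilon>} \<in> ideal_filter \<Gamma> I)"
      unfolding upper_bornological_lim_def upper_cylinders[symmetric] by blast
    also have "\<dots> \<longleftrightarrow> upper_partial_map_lim X d Y \<mu> \<B> \<Gamma> I D u Dn un"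
      by (simp add: upper_partial_map_lim_def upper_indices) blast
    finally show "upper_bornological_lim (X \<times> Y) (box_dist d \<mu>) (star_bornology Y \<B>) \<Gamma> I
            (Gr D u) (\<lambda>\<gamma>. Gr (Dn \<gamma>) (un \<gamma>)) \<longleftrightarrow>
          upper_partial_map_lim X d Y \<mu> \<B> \<Gamma> I D u Dn un" .
  qed
qed

end
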